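(* Let $\bar c\in\mathcal C$ be a null vertex of $\operatorname{conv}(\mathcal C)$. Then $\operatorname{conv}(\frac12(d+\mathcal W))$ lies in the closed half-space $\{\bar x: J(\bar c,\bar x)\ge0\}$.
   Context: Setting: $G$ compact Lie group, $K\subset G$ closed, $G/K$ connected almost effective, isotropy representation $\mathfrak p=\mathfrak p_1\oplus\cdots\oplus\mathfrak p_r$ ($r\ge2$) with pairwise inequivalent $\mathbb R$-irreducible summands, $d_i=\dim\mathfrak p_i$, $d=(d_1,\dots,d_r)$, $n=\sum d_i$. The scalar curvature of the metric $e^{q_i}Q$ on $\mathfrak p_i$ is $S(q)=\sum_{w\in\mathcal W}A_we^{w\cdot q}$, $\mathcal W\subset\mathbb Z^r$ finite, $A_w\ne0$, each $w$ of type I (one entry $-1$), type II (one entry $1$, two entries $-1$) or type III (one entry $1$, one entry $-2$), other entries $0$; $A_w>0$ for type I and $<0$ otherwise. Assume $\dim\operatorname{conv}(\mathcal W)=r-1$. $J$ is the symmetric bilinear form with $J(p,p)=\frac1{n-1}(\sum p_i)^2-\sum p_i^2/d_i$; null means $J(\bar x,\bar x)=0$. $u=\sum_{\bar c\in\mathcal C}F_{\bar c}e^{\bar c\cdot q}$ ($\mathcal C$ finite, $F_{\bar c}\ne0$) is a superpotential: for every $\xi$, $\sum_{(\bar a,\bar c)\in\mathcal C^2,\ \bar a+\bar c=\xi}J(\bar a,\bar c)F_{\bar a}F_{\bar c}$ equals $A_w$ if $\xi=d+w$, $w\in\mathcal W$, and $0$ otherwise; $\mathcal C$ is normalised to lie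 in $\{\sum\bar x_i=\frac12(n-1)\}$. *)

theory Defs
  imports "HOL-Analysis.Analysis"
begin

definition dvec :: "nat^'r \<Rightarrow> real^'r" where
  "dvec d = (\<chi> i. real (d $ i))"

definition ndim :: "nat^'r::finite \<Rightarrow> real" where
  "ndim d = (\<Sum>i\<in>UNIV. real (d $ i))"

definition Jform :: "nat^'r::finite \<Rightarrow> real^'r \<Rightarrow> real^'r \<Rightarrow> real" where
  "Jform d p q = (1 / (ndim d - 1)) * (\<Sum>i\<in>UNIV. p $ i) * (\<Sum>i\<in>UNIV. q $ i)
      - (\<Sum>i\<in>UNIV. p $ i * q $ i / real (d $ i))"

definition null_vec :: "nat^'r::finite \<Rightarrow> real^'r \<Rightarrow> bool" where
  "null_vec d x \<longleftrightarrow> Jform d x x = 0"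

definition typeI :: "real^'r \<Rightarrow> bool" where
  "typeI w \<longleftrightarrow> (\<exists>i. w $ i = -1 \<and> (\<forall>k. k \<noteq> i \<longrightarrow> w $ k = 0))"

definition typeII :: "real^'r \<Rightarrow> bool" where
  "typeII w \<longleftrightarrow> (\<exists>i j k. i \<noteq> j \<and> i \<noteq> k \<and> j \<noteq> k \<and>
      w $ i = 1 \<and> w $ j = -1 \<and> w $ k = -1 \<and>
      (\<forall>l. l \<noteq> i \<and> l \<noteq> j \<and> l \<noteq> k \<longrightarrow> w $ l = 0))"

definition typeIII :: "real^'r \<Rightarrow> bool" where
  "typeIII w \<longleftrightarrow> (\<exists>i j. i \<noteq> j \<and> w $ i = 1 \<and> w $ j = -2 \<and>
      (\<forall>l. l \<noteq> i \<and> l \<noteq> j \<longrightarrow> w $ l = 0))"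

text \<open>u = sum_{c in C} F_c e^{c.q} is a superpotential for S = sum_{w in W} A_w e^{w.q}.\<close>
definition superpotential ::
  "nat^'r::finite \<Rightarrow> (real^'r) set \<Rightarrow> (real^'r \<Rightarrow> real) \<Rightarrow> (real^'r) set \<Rightarrow> (real^'r \<Rightarrow> real) \<Rightarrow> bool" where
  "superpotential d W A C F \<longleftrightarrow>
     (\<forall>\<xi>. (\<Sum>p\<in>{p \<in> C \<times> C. fst p + snd p = \<xi>}. Jform d (fst p) (snd p) * F (fst p) * F (snd p))
          = (if \<xi> - dvec d \<in> W then A (\<xi> - dvec d) else 0))"

end

theory Submission
  imports Defs
begin

text \<open>Suppose some point of \<open>C\<close> lies strictly on the negative side of the hyperplane \<open>J(c, \<cdot>) = 0\<close>.
  Then so does an edge \<open>c + t y\<close> (\<open>t > 0\<close>) of \<open>conv C\<close> at \<open>c\<close>, and \<open>J < 0\<close> for any two points of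
  \<open>C\<close> on this edge that are not both \<open>c\<close>. The sums of \<open>c\<close> and its nearest neighbour, of the far
  endpoint \<open>a\<close> with itself, and of \<open>a\<close> and its nearest neighbour each arise from only one unordered
  pair in \<open>C\<close>, so they lie in \<open>d + W\<close>. With \<open>2 c = d + v\<close> and \<open>2 a = d + w\<close>, integrality of
  the elements of \<open>W\<close> shows that no \<open>v\<^sub>i\<close> lies strictly between \<open>0\<close> and \<open>w\<^sub>i\<close>. Since \<open>c\<close> is null,
  \<open>4 J(c, a) = - \<Sum>\<^sub>i v\<^sub>i (w\<^sub>i - v\<^sub>i) / d\<^sub>i \<ge> 0\<close>, a contradiction.\<close>

section \<open>Bilinearity and values of the form \<open>J\<close>\<close>

lemma Jform_commute: "Jform d p q = Jform d q p"
  by (simp add: Jform_def mult.commute)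

lemma Jform_add_right: "Jform d p (q + q') = Jform d p q + Jform d p q'"
  by (simp add: Jform_def sum.distrib algebra_simps add_divide_distrib)

lemma Jform_scaleR_right: "Jform d p (t *\<^sub>R q) = t * Jform d p q"
proof -
  have "(\<Sum>i\<in>UNIV. p $ i * (t * q $ i) / real (d $ i)) = t * (\<Sum>i\<in>UNIV. p $ i * q $ i / real (d $ i))"
    unfolding sum_distrib_left by (intro sum.cong) auto
  moreover have "(\<Sum>i\<in>UNIV. t * q $ i) = t * (\<Sum>i\<in>UNIV. q $ i)"
    by (simp add: sum_distrib_left)
  ultimately show ?thesis
    by (simp add: Jform_def right_diff_distrib)
qed

lemma linear_Jform: "linear (Jform d p)"
  by (rule linearI) (simp_all add: Jform_add_right Jform_scaleR_right)

lemma Jform_add_left: "Jform d (p + p') q = Jform d p q + Jform d p' q"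
  by (metis Jform_commute Jform_add_right)

lemma Jform_scaleR_left: "Jform d (t *\<^sub>R p) q = t * Jform d p q"
  by (metis Jform_commute Jform_scaleR_right)

text \<open>The only positive term of \<open>J\<close> is the squared coordinate sum. Differences of
  points of \<open>C\<close> have coordinate sum zero, which is where this is applied.\<close>

lemma Jform_self_nonpos:
  assumes "(\<Sum>i\<in>UNIV. y $ i) = 0"
  shows "Jform d y y \<le> 0"
  using assms by (simp add: Jform_def sum_nonneg)

text \<open>Both arguments have coordinate sum \<open>n - 1\<close>, so the first term of
  \<open>J\<close> is \<open>n - 1\<close>; the linear terms of the expanded products sum to
  \<open>n - 2\<close>.\<close>

lemma Jform_dvec_add:
  assumes "\<forall>i. d $ i \<ge> 1" "ndim d \<noteq> 1" "(\<Sum>i\<in>UNIV. v $ i) = -1" "(\<Sum>i\<in>UNIV. w $ i) = -1"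
  shows "Jform d (dvec d + v) (dvec d + w) = 1 - (\<Sum>i\<in>UNIV. v $ i * w $ i / real (d $ i))"
proof -
  have s: "(\<Sum>i\<in>UNIV. (dvec d + z) $ i) = ndim d - 1" if "(\<Sum>i\<in>UNIV. z $ i) = -1" for z
    using that by (simp add: dvec_def ndim_def sum.distrib)
  have "(dvec d + v) $ i * (dvec d + w) $ i / real (d $ i)
      = real (d $ i) + v $ i + w $ i + v $ i * w $ i / real (d $ i)" for i
  proof -
    have "real (d $ i) \<noteq> 0"
      using assms(1)[rule_format, of i] by simp
    then show ?thesis by (simp add: dvec_def field_simps)
  qed
  then have "(\<Sum>i\<in>UNIV. (dvec d + v) $ i * (dvec d + w) $ i / real (d $ i))
      = ndim d - 2 + (\<Sum>i\<in>UNIV. v $ i * w $ i / real (d $ i))"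
    using assms(3,4) by (simp add: sum.distrib ndim_def)
  then show ?thesis
    unfolding Jform_def s[OF assms(3)] s[OF assms(4)] using assms(2) by simp
qed

text \<open>The edge argument needs only this about the three types: entries are integers from -2 to
  1, which leaves little room for several of them in arithmetic order.\<close>

lemma weight_entry:
  assumes "typeI w \<or> typeII w \<or> typeIII w"
  obtains z :: int where "w $ i = of_int z" "z \<in> {-2, -1, 0, 1}"
proof -
  have "w $ i = -2 \<or> w $ i = -1 \<or> w $ i = 0 \<or> w $ i = 1"
    using assms
  proof (elim disjE)
    assume "typeI w"
    then show ?thesis unfolding typeI_def by metis
  next
    assume "typeII w"
    then obtain j k l where "w $ j = 1" "w $ k = -1" "w $ l = -1"
      "\<forall>h. h \<noteq> j \<and> h \<noteq> k \<and> h \<noteq> l \<longrightarrow> w $ h = 0"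
      unfolding typeII_def by blast
    then show ?thesis by (cases "i = j \<or> i = k \<or> i = l") auto
  next
    assume "typeIII w"
    then obtain j k where "w $ j = 1" "w $ k = -2" "\<forall>h. h \<noteq> j \<and> h \<noteq> k \<longrightarrow> w $ h = 0"
      unfolding typeIII_def by blast
    then show ?thesis by (cases "i = j \<or> i = k") auto
  qed
  then have "w $ i = of_int (-2) \<or> w $ i = of_int (-1) \<or> w $ i = of_int 0 \<or> w $ i = of_int 1"
    by simp
  then show ?thesis using that by blast
qed

section \<open>Vertices and edges of polytopes\<close>

text \<open>Faces of a polyhedron are exposed. The library functional is maximal on the face, hence
  the sign change that makes \<open>x\<close> the strict minimiser.\<close>

lemma extreme_point_exposed:
  fixes S :: "'a::euclidean_space set"
  assumes "finite S" "x extreme_point_of (convex hull S)"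
  obtains a where "\<And>y. y \<in> S \<Longrightarrow> y \<noteq> x \<Longrightarrow> a \<bullet> x < a \<bullet> y"
proof -
  have "polyhedron (convex hull S)"
    using assms(1) by (simp add: polytope_convex_hull polytope_imp_polyhedron)
  then have "{x} exposed_face_of (convex hull S)"
    using assms(2) by (simp add: exposed_face_of_polyhedron face_of_singleton)
  then obtain a b where ab: "convex hull S \<subseteq> {y. a \<bullet> y \<le> b}" "{x} = convex hull S \<inter> {y. a \<bullet> y = b}"
    unfolding exposed_face_of_def by auto
  have "(-a) \<bullet> x < (-a) \<bullet> y" if "y \<in> S" "y \<noteq> x" for y
  proof -
    have "y \<in> convex hull S" using that(1) by (rule hull_inc)
    moreover have "a \<bullet> x = b" using ab(2) by blast
    ultimately show ?thesis using ab that(2) by (auto simp: order_less_le)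
  qed
  then show ?thesis using that by blast
qed

text \<open>Edges at a vertex correspond to the vertices of the vertex figure, i.e. the projection of the other
  points from \<open>c\<close> to a hyperplane \<open>l \<bullet> (x - c) = 1\<close>.\<close>

lemma edge_direction_exists:
  fixes C :: "'a::euclidean_space set" and g :: "'a \<Rightarrow> real"
  assumes "finite C" "c extreme_point_of (convex hull C)" "linear g"
    and "p \<in> C" "g (p - c) < 0"
  obtains y m t where "g y < 0" "\<And>x. x \<in> C \<Longrightarrow> m \<bullet> (x - c) \<ge> 0"
    "\<And>x. x \<in> C \<Longrightarrow> m \<bullet> (x - c) = 0 \<Longrightarrow> \<exists>t\<ge>0. x = c + t *\<^sub>R y"
    "t > 0" "c + t *\<^sub>R y \<in> C" "m \<bullet> y = 0"
proof -
  obtain l where l: "\<And>x. x \<in> C \<Longrightarrow> x \<noteq> c \<Longrightarrow> l \<bullet> c < l \<bullet> x"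
    using extreme_point_exposed[OF assms(1,2)] by blast
  define h where "h x = (1 / (l \<bullet> (x - c))) *\<^sub>R (x - c)" for x
  define Y where "Y = h ` (C - {c})"
  have lpos: "l \<bullet> (x - c) > 0" if "x \<in> C" "x \<noteq> c" for x
    using l[OF that] by (simp add: inner_diff_right)
  have fY: "finite Y" using assms(1) by (simp add: Y_def)
  have gh: "g (h x) = g (x - c) / (l \<bullet> (x - c))" for x
    by (simp add: h_def linear_cmul[OF assms(3)])
  have pc: "p \<noteq> c" using assms(3,5) linear_0 by fastforce
  \<comment> \<open>If \<open>g\<close> were non-negative at every vertex of the vertex figure,
    Krein-Milman would make it non-negative at \<open>h p\<close>, a positive multiple of
    \<open>p - c\<close>.\<close>
  have "\<exists>y. y extreme_point_of (convex hull Y) \<and> g y < 0"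
  proof (rule ccontr)
    assume "\<not> ?thesis"
    then have sub: "{y. y extreme_point_of (convex hull Y)} \<subseteq> {y. g y \<ge> 0}"
      by force
    have "convex {y. g y \<ge> 0}"
      using assms(3) by (auto simp: convex_def linear_add linear_cmul)
    then have "convex hull {y. y extreme_point_of (convex hull Y)} \<subseteq> {y. g y \<ge> 0}"
      using sub by (rule hull_minimal[rotated])
    moreover have "convex hull Y = convex hull {y. y extreme_point_of (convex hull Y)}"
      using fY by (intro Krein_Milman_Minkowski) (simp_all add: finite_imp_compact_convex_hull)
    moreover have "h p \<in> convex hull Y"
      using assms(4) pc by (intro hull_inc) (simp add: Y_def)
    ultimately have "g (h p) \<ge> 0" by blast
    moreover have "g (h p) < 0"
      using assms(5) lpos[OF assms(4) pc] by (simp add: gh divide_neg_pos)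
    ultimately show False by simp
  qed
  then obtain y where y: "y extreme_point_of (convex hull Y)" "g y < 0" by blast
  have "y \<in> Y" using y(1) by (rule extreme_point_of_convex_hull)
  then obtain q where q: "q \<in> C" "q \<noteq> c" "y = h q" by (auto simp: Y_def)
  obtain b where b: "\<And>z. z \<in> Y \<Longrightarrow> z \<noteq> y \<Longrightarrow> b \<bullet> y < b \<bullet> z"
    using extreme_point_exposed[OF fY y(1)] by blast
  \<comment> \<open>Subtracting a multiple of \<open>l\<close> turns the affine functional exposing
    \<open>y\<close> in the vertex figure into a linear one that vanishes on \<open>y\<close> and
    supports the whole cone of \<open>C\<close> at \<open>c\<close>.\<close>
  define m where "m = b - (b \<bullet> y) *\<^sub>R l"
  have hx: "x - c = (l \<bullet> (x - c)) *\<^sub>R h x" if "x \<in> C" "x \<noteq> c" for x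
    using lpos[OF that] by (simp add: h_def)
  have mx: "m \<bullet> (x - c) = (l \<bullet> (x - c)) * (b \<bullet> h x - b \<bullet> y)" if "x \<in> C" "x \<noteq> c" for x
  proof -
    have "b \<bullet> (x - c) = (l \<bullet> (x - c)) * (b \<bullet> h x)"
      using hx[OF that] by (metis inner_scaleR_right)
    then show ?thesis by (simp add: m_def algebra_simps)
  qed
  have hY: "h x \<in> Y" if "x \<in> C" "x \<noteq> c" for x
    using that by (simp add: Y_def)
  show ?thesis
  proof (rule that[of y m "l \<bullet> (q - c)"])
    show "g y < 0" by fact
    show "m \<bullet> (x - c) \<ge> 0" if "x \<in> C" for x
    proof (cases "x = c")
      case False
      then have "b \<bullet> h x \<ge> b \<bullet> y"
        using b[OF hY[OF that]] by (cases "h x = y") auto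
      then show ?thesis
        using mx[OF that False] lpos[OF that False] by simp
    qed simp
    show "\<exists>t\<ge>0. x = c + t *\<^sub>R y" if "x \<in> C" "m \<bullet> (x - c) = 0" for x
    proof (cases "x = c")
      case True
      then show ?thesis by (intro exI[of _ 0]) simp
    next
      case False
      then have "b \<bullet> h x = b \<bullet> y"
        using mx[OF that(1) False] lpos[OF that(1) False] that(2) by simp
      then have "h x = y"
        using b[OF hY[OF that(1) False]] by fastforce
      then have "x = c + (l \<bullet> (x - c)) *\<^sub>R y"
        using hx[OF that(1) False] by (simp add: algebra_simps)
      then show ?thesis
        using lpos[OF that(1) False] by (metis less_imp_le)
    qed
    show "l \<bullet> (q - c) > 0" using lpos q by blast
    show "c + (l \<bullet> (q - c)) *\<^sub>R y \<in> C"
      unfolding q(3) using hx[OF q(1,2)] q(1) by (metis diff_add_cancel add.commute)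
    have "m \<bullet> (q - c) = 0" using mx[OF q(1,2)] q(3) by simp
    then show "m \<bullet> y = 0" by (simp add: q(3) h_def)
  qed
qed

section \<open>Consequences of the superpotential equation\<close>

text \<open>The coefficient at \<open>a + b\<close> reduces to one or two copies of
  \<open>J(a, b) F(a) F(b)\<close>, depending on whether \<open>a = b\<close>. Nothing can cancel
  it.\<close>

lemma superpotential_unique_sum:
  assumes "superpotential d W A C F" "\<forall>x\<in>C. F x \<noteq> 0" "a \<in> C" "b \<in> C" "Jform d a b \<noteq> 0"
    and uniq: "\<And>p q. p \<in> C \<Longrightarrow> q \<in> C \<Longrightarrow> p + q = a + b \<Longrightarrow> (p, q) = (a, b) \<or> (p, q) = (b, a)"
  shows "a + b - dvec d \<in> W"
proof (rule ccontr)
  assume "a + b - dvec d \<notin> W"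
  then have "(\<Sum>p\<in>{p \<in> C \<times> C. fst p + snd p = a + b}. Jform d (fst p) (snd p) * F (fst p) * F (snd p)) = 0"
    using assms(1) unfolding superpotential_def by simp
  moreover have "{p \<in> C \<times> C. fst p + snd p = a + b} = {(a, b), (b, a)}"
  proof (intro equalityI subsetI)
    fix z assume "z \<in> {p \<in> C \<times> C. fst p + snd p = a + b}"
    then show "z \<in> {(a, b), (b, a)}"
      using uniq[of "fst z" "snd z"] by (simp add: mem_Times_iff)
  qed (use assms(3,4) in \<open>auto simp: add.commute\<close>)
  ultimately have "(\<Sum>p\<in>{(a, b), (b, a)}. Jform d (fst p) (snd p) * F (fst p) * F (snd p)) = 0"
    by simp
  then show False
    using assms(2-5) Jform_commute[of d a b] by (cases "a = b") auto
qed

lemma superpotential_sum_exists: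
  assumes "superpotential d W A C F" "w \<in> W" "A w \<noteq> 0"
  obtains p q where "p \<in> C" "q \<in> C" "p + q = dvec d + w"
proof -
  have "(\<Sum>p\<in>{p \<in> C \<times> C. fst p + snd p = dvec d + w}. Jform d (fst p) (snd p) * F (fst p) * F (snd p)) \<noteq> 0"
    using assms unfolding superpotential_def by simp
  then have "{p \<in> C \<times> C. fst p + snd p = dvec d + w} \<noteq> {}"
    using sum.empty by force
  then obtain p where "p \<in> C \<times> C" "fst p + snd p = dvec d + w"
    by blast
  then show ?thesis using that[of "fst p" "snd p"] by auto
qed

section \<open>The sign of \<open>J(c, \<cdot>)\<close> on \<open>C\<close>\<close>

lemma superpotential_nonneg_at_null_vertex:
  fixes d :: "nat^'r::finite" and C W :: "(real^'r) set"
  assumes dpos: "\<forall>i. d $ i \<ge> 1" and n1: "ndim d \<noteq> 1"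
    and Wtypes: "\<forall>w\<in>W. typeI w \<or> typeII w \<or> typeIII w"
    and Cfin: "finite C" and Fnz: "\<forall>x\<in>C. F x \<noteq> 0"
    and Cnorm: "\<forall>x\<in>C. (\<Sum>i\<in>UNIV. x $ i) = (ndim d - 1) / 2"
    and sp: "superpotential d W A C F"
    and cC: "c \<in> C" and cvert: "c extreme_point_of (convex hull C)" and cnull: "null_vec d c"
    and "p \<in> C"
  shows "Jform d c p \<ge> 0"
proof (rule ccontr)
  assume "\<not> Jform d c p \<ge> 0"
  then have "Jform d c (p - c) < 0"
    using cnull by (simp add: null_vec_def linear_diff[OF linear_Jform])
  then obtain y m t\<^sub>0 where Jy: "Jform d c y < 0"
    and m0: "\<And>x. x \<in> C \<Longrightarrow> m \<bullet> (x - c) \<ge> 0"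
    and m1: "\<And>x. x \<in> C \<Longrightarrow> m \<bullet> (x - c) = 0 \<Longrightarrow> \<exists>t\<ge>0. x = c + t *\<^sub>R y"
    and t0: "t\<^sub>0 > 0" "c + t\<^sub>0 *\<^sub>R y \<in> C" and my: "m \<bullet> y = 0"
    using edge_direction_exists[OF Cfin cvert linear_Jform \<open>p \<in> C\<close>] by metis
  define e where "e t = c + t *\<^sub>R y" for t :: real
  have y0: "y \<noteq> 0" using Jy linear_0[OF linear_Jform[of d c]] by auto
  have e_inj: "e s = e t \<longleftrightarrow> s = t" for s t using y0 by (simp add: e_def)
  have e_add: "e s + e t = 2 *\<^sub>R c + (s + t) *\<^sub>R y" for s t
    by (simp add: e_def algebra_simps scaleR_2)
  define T where "T = {t. e t \<in> C}"
  have Tfin: "finite T"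
    using finite_vimageI[OF Cfin, of e] e_inj by (simp add: T_def vimage_def inj_def)
  have T_nonneg: "t \<ge> 0" if "t \<in> T" for t
  proof -
    have "e t \<in> C" using that by (simp add: T_def)
    moreover have "m \<bullet> (e t - c) = 0" using my by (simp add: e_def)
    ultimately obtain s where "s \<ge> 0" "e t = e s" using m1[of "e t"] unfolding e_def by blast
    then show ?thesis by (simp add: e_inj)
  qed
  have zT: "0 \<in> T" using cC by (simp add: T_def e_def)
  \<comment> \<open>The edge is a face: \<open>m\<close> is non-negative at \<open>p - c\<close> and
    \<open>q - c\<close> and vanishes on their sum, so it vanishes on both and each point lies on
    the edge.\<close>
  have split_sum: "\<exists>s\<in>T. \<exists>t\<in>T. p = e s \<and> q = e t \<and> s + t = \<sigma>"
    if "p \<in> C" "q \<in> C" "p + q = 2 *\<^sub>R c + \<sigma> *\<^sub>R y" for p q \<sigma>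
  proof -
    have "(p - c) + (q - c) = \<sigma> *\<^sub>R y" using that(3) by (simp add: algebra_simps scaleR_2)
    then have "m \<bullet> (p - c) + m \<bullet> (q - c) = 0"
      by (metis inner_add_right inner_scaleR_right mult_zero_right my)
    then have "m \<bullet> (p - c) = 0" "m \<bullet> (q - c) = 0"
      using m0[OF that(1)] m0[OF that(2)] by linarith+
    then obtain s t where st: "p = e s" "q = e t"
      using m1[OF \<open>p \<in> C\<close>] m1[OF \<open>q \<in> C\<close>] unfolding e_def by blast
    then have "s + t = \<sigma>" using that(3) y0 by (simp add: e_add)
    then show ?thesis using st that(1,2) by (auto simp: T_def)
  qed
  have "(\<Sum>i\<in>UNIV. (c + t\<^sub>0 *\<^sub>R y) $ i) = (\<Sum>i\<in>UNIV. c $ i)"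
    using Cnorm[rule_format, OF cC] Cnorm[rule_format, OF t0(2)] by metis
  then have ysum: "(\<Sum>i\<in>UNIV. y $ i) = 0"
    using t0(1) by (simp add: sum.distrib flip: sum_distrib_left)
  \<comment> \<open>As \<open>c\<close> is null, the expansion has no constant term; the linear part
    is negative and the quadratic part is at most zero. Taking \<open>t > 0\<close> excludes the
    pair \<open>(c, c)\<close>.\<close>
  have Jneg: "Jform d (e s) (e t) < 0" if "s \<ge> 0" "t > 0" for s t
  proof -
    have "Jform d (e s) (e t) = (s + t) * Jform d c y + (s * t) * Jform d y y"
      using cnull Jform_commute[of d y c]
      by (simp add: e_def null_vec_def Jform_add_left Jform_add_right Jform_scaleR_left
          Jform_scaleR_right algebra_simps)
    moreover have "(s + t) * Jform d c y < 0" using that Jy by (simp add: mult_pos_neg)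
    moreover have "(s * t) * Jform d y y \<le> 0"
      using that Jform_self_nonpos[OF ysum] by (simp add: mult_nonneg_nonpos)
    ultimately show ?thesis by linarith
  qed
  define w where "w \<sigma> = 2 *\<^sub>R c + \<sigma> *\<^sub>R y - dvec d" for \<sigma>
  have inW: "w (s + t) \<in> W" if "s \<in> T" "t \<in> T" "t > 0"
    and uniq: "\<And>s' t'. s' \<in> T \<Longrightarrow> t' \<in> T \<Longrightarrow> s' + t' = s + t \<Longrightarrow> s' = s \<or> s' = t" for s t
  proof -
    have "e s + e t - dvec d \<in> W"
    proof (rule superpotential_unique_sum[OF sp Fnz])
      show "e s \<in> C" "e t \<in> C" using that by (simp_all add: T_def)
      show "Jform d (e s) (e t) \<noteq> 0" using Jneg that T_nonneg by (metis less_irrefl)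
      fix p q assume pq: "p \<in> C" "q \<in> C" "p + q = e s + e t"
      then obtain s' t' where st: "s' \<in> T" "t' \<in> T" "p = e s'" "q = e t'" "s' + t' = s + t"
        using split_sum[of p q "s + t"] by (auto simp: e_add)
      then have "s' = s \<or> s' = t" using uniq by blast
      then show "(p, q) = (e s, e t) \<or> (p, q) = (e t, e s)" using st by auto
    qed
    then show ?thesis by (simp add: w_def e_add)
  qed
  \<comment> \<open>\<open>M\<close> is the parameter of the far endpoint of the edge,
    \<open>t\<^sub>1\<close> that of the point of \<open>C\<close> nearest to
    \<open>c\<close>.\<close>
  define M where "M = Max T"
  define t\<^sub>1 where "t\<^sub>1 = Min (T - {0})"
  have tT: "t\<^sub>0 \<in> T" using t0 by (simp add: T_def e_def)
  have M: "M \<in> T" "\<And>t. t \<in> T \<Longrightarrow> t \<le> M"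
    using Tfin zT unfolding M_def by (auto intro: Max_in)
  have Mpos: "M > 0" using M(2)[OF tT] t0(1) by simp
  have "t\<^sub>1 \<in> T - {0}" unfolding t\<^sub>1_def using Tfin tT t0(1) by (intro Min_in) auto
  then have t1: "t\<^sub>1 \<in> T" "t\<^sub>1 > 0" using T_nonneg[of t\<^sub>1] by auto
  have t1_le: "t\<^sub>1 \<le> t" if "t \<in> T" "t \<noteq> 0" for t
    unfolding t\<^sub>1_def using Tfin that by simp
  have t1M: "t\<^sub>1 \<le> M" using M(2) t1 by blast
  have "w (0 + t\<^sub>1) \<in> W"
  proof (rule inW[OF zT t1])
    fix s' t' assume "s' \<in> T" "t' \<in> T" "s' + t' = 0 + t\<^sub>1"
    then show "s' = 0 \<or> s' = t\<^sub>1"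
      using t1_le[of s'] t1_le[of t'] T_nonneg[of t'] by fastforce
  qed
  then have w1: "w t\<^sub>1 \<in> W" by simp
  have "w (M + M) \<in> W"
  proof (rule inW[OF M(1) M(1) Mpos])
    fix s' t' assume "s' \<in> T" "t' \<in> T" "s' + t' = M + M"
    then show "s' = M \<or> s' = M" using M(2)[of s'] M(2)[of t'] by linarith
  qed
  then have w2: "w (2 * M) \<in> W" by (simp only: mult_2)
  have w3: "\<exists>t. M < t \<and> t < 2 * M \<and> w t \<in> W" if "t\<^sub>1 < M"
  proof -
    \<comment> \<open>\<open>k\<close> belongs to the nearest neighbour of the far endpoint. The
      assumption \<open>t\<^sub>1 < M\<close> keeps it away from \<open>c\<close>, so
      \<open>k + M\<close> exceeds \<open>M\<close>.\<close>
    define k where "k = Max (T - {M})"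
    have fin: "finite (T - {M})" using Tfin by simp
    have "t\<^sub>1 \<in> T - {M}" using that t1 by simp
    then have k: "k \<in> T - {M}" "\<And>t. t \<in> T - {M} \<Longrightarrow> t \<le> k"
      unfolding k_def using Max_in[OF fin] Max_ge[OF fin] by blast+
    have k1: "t\<^sub>1 \<le> k" using that t1 by (intro k(2)) simp
    have kM: "k < M" using k(1) M(2)[of k] by auto
    have "w (k + M) \<in> W"
    proof (rule inW[OF _ M(1) Mpos])
      show "k \<in> T" using k by simp
      fix s' t' assume st: "s' \<in> T" "t' \<in> T" "s' + t' = k + M"
      show "s' = k \<or> s' = M"
      proof (rule ccontr)
        assume "\<not> ?thesis"
        then have "s' < k" using k(2)[of s'] st(1) by auto
        then show False using M(2)[OF st(2)] st(3) by linarith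
      qed
    qed
    then show ?thesis using k1 kM t1 by (intro exI[of _ "k + M"]) auto
  qed
  have wi: "w \<sigma> $ i = w 0 $ i + \<sigma> * y $ i" for \<sigma> i
    by (simp add: w_def)
  \<comment> \<open>Otherwise \<open>v\<close> and \<open>z\<close> have the same strict sign, so
    the entries of \<open>w \<sigma>\<close> move away from zero as \<open>\<sigma>\<close>
    grows.\<close>
  have entry: "w 0 $ i * (w (2 * M) $ i - w 0 $ i) \<le> 0" for i
  proof (rule ccontr)
    assume pos: "\<not> ?thesis"
    define z where "z = y $ i"
    define v where "v = w 0 $ i"
    obtain a\<^sub>1 where a1: "v + t\<^sub>1 * z = of_int a\<^sub>1"
      using weight_entry[of "w t\<^sub>1" i] Wtypes w1 wi v_def z_def by metis
    obtain a\<^sub>2 where a2: "v + 2 * M * z = of_int a\<^sub>2" "a\<^sub>2 \<in> {-2, -1, 0, 1}"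
      using weight_entry[of "w (2 * M)" i] Wtypes w2 wi v_def z_def by metis
    have a12: "of_int (a\<^sub>2 - a\<^sub>1) = (2 * M - t\<^sub>1) * z" using a1 a2(1) by (simp add: algebra_simps)
    have vz: "v * z > 0"
      using pos Mpos wi[of "2 * M" i] by (auto simp: v_def z_def not_le zero_less_mult_iff)
    show False
    proof (cases "z > 0")
      \<comment> \<open>Here the integers satisfy \<open>0 < a\<^sub>1 < a\<^sub>2\<close>, although
        no entry exceeds 1.\<close>
      case True
      then have "v > 0" using vz by (simp add: zero_less_mult_iff)
      then have "a\<^sub>1 > 0" using a1 True t1(2) by (metis add_pos_pos mult_pos_pos of_int_0_less_iff)
      moreover have "(2 * M - t\<^sub>1) * z > 0" using True t1M Mpos by simp
      then have "a\<^sub>2 > a\<^sub>1" using a12 by linarith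
      ultimately show False using a2(2) by auto
    next
      case False
      then have z: "z < 0" using vz by (cases "z = 0") auto
      then have v: "v < 0" using vz by (simp add: zero_less_mult_iff)
      have "t\<^sub>1 * z < 0" using z t1(2) by (simp add: mult_pos_neg)
      then have "of_int a\<^sub>1 < (0::real)" using a1 v by linarith
      then have "a\<^sub>1 < 0" by simp
      moreover have "(2 * M - t\<^sub>1) * z < 0" using z t1M Mpos by (simp add: mult_pos_neg)
      then have "a\<^sub>2 < a\<^sub>1" using a12 by linarith
      ultimately have a: "a\<^sub>2 = -2" "a\<^sub>1 = -1" using a2(2) by auto
      \<comment> \<open>If \<open>t\<^sub>1 = M\<close>, the values -1 at \<open>M\<close> and -2 at
        \<open>2 * M\<close> extrapolate to \<open>v = 0\<close>.\<close>
      have "t\<^sub>1 < M"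
      proof (rule ccontr)
        assume "\<not> t\<^sub>1 < M"
        then have "t\<^sub>1 = M" using t1M by simp
        then show False using a a1 a2(1) v by simp
      qed
      \<comment> \<open>The third weight would have an integer entry strictly between -2 and
        -1.\<close>
      then obtain t where t: "M < t" "t < 2 * M" "w t \<in> W" using w3 by blast
      obtain a\<^sub>3 where a3: "v + t * z = of_int a\<^sub>3"
        using weight_entry[of "w t" i] Wtypes t(3) wi v_def z_def by metis
      have "2 * M * z < t * z" "t * z < t\<^sub>1 * z"
        using t t1M z by (simp_all add: mult_less_cancel_right)
      then have "real_of_int a\<^sub>2 < of_int a\<^sub>3" "real_of_int a\<^sub>3 < of_int a\<^sub>1"
        using a1 a2(1) a3 by linarith+
      then have "a\<^sub>2 < a\<^sub>3" "a\<^sub>3 < a\<^sub>1" by simp_all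
      then show False using a by simp
    qed
  qed
  have wsum: "(\<Sum>i\<in>UNIV. w \<sigma> $ i) = -1" for \<sigma>
    using Cnorm[rule_format, OF cC] ysum
    by (simp add: w_def sum.distrib sum_subtractf dvec_def ndim_def flip: sum_distrib_left)
  have dw: "dvec d + w 0 = 2 *\<^sub>R e 0" "dvec d + w (2 * M) = 2 *\<^sub>R e M"
    by (simp_all add: w_def e_def algebra_simps)
  \<comment> \<open>Subtracting the formulas for \<open>4 J(c, c) = 0\<close> and
    \<open>4 J(c, e M) < 0\<close> removes the constant 1 and leaves a sum that \<open>entry\<close>
    bounds above by zero.\<close>
  have "Jform d (2 *\<^sub>R e 0) (2 *\<^sub>R e 0) = 1 - (\<Sum>i\<in>UNIV. w 0 $ i * w 0 $ i / real (d $ i))"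
    using Jform_dvec_add[OF dpos n1 wsum wsum, of 0 0] unfolding dw .
  moreover have "Jform d (2 *\<^sub>R e 0) (2 *\<^sub>R e 0) = 0"
    using cnull by (simp add: Jform_scaleR_left Jform_scaleR_right null_vec_def e_def)
  moreover have "Jform d (2 *\<^sub>R e 0) (2 *\<^sub>R e M) = 1 - (\<Sum>i\<in>UNIV. w 0 $ i * w (2 * M) $ i / real (d $ i))"
    using Jform_dvec_add[OF dpos n1 wsum wsum, of 0 "2 * M"] unfolding dw .
  moreover have "Jform d (2 *\<^sub>R e 0) (2 *\<^sub>R e M) < 0"
    using Jneg[of 0 M] Mpos by (simp add: Jform_scaleR_left Jform_scaleR_right)
  ultimately have "(\<Sum>i\<in>UNIV. w 0 $ i * (w (2 * M) $ i - w 0 $ i) / real (d $ i)) > 0"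
    by (simp add: right_diff_distrib diff_divide_distrib sum_subtractf)
  moreover have "(\<Sum>i\<in>UNIV. w 0 $ i * (w (2 * M) $ i - w 0 $ i) / real (d $ i)) \<le> 0"
    using entry by (intro sum_nonpos) (simp add: divide_nonpos_nonneg)
  ultimately show False by simp
qed

section \<open>From points of \<open>C\<close> to the weight polytope\<close>

theorem theorem4p1:
  fixes d :: "nat^'r::finite"
    and W :: "(real^'r) set" and A :: "real^'r \<Rightarrow> real"
    and C :: "(real^'r) set" and F :: "real^'r \<Rightarrow> real"
    and c :: "real^'r"
  assumes r2: "CARD('r) \<ge> 2"
    and dpos: "\<forall>i. d $ i \<ge> 1"
    and Wfin: "finite W"
    and Wtypes: "\<forall>w\<in>W. typeI w \<or> typeII w \<or> typeIII w"
    and Anz: "\<forall>w\<in>W. A w \<noteq> 0"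
    and Apos: "\<forall>w\<in>W. typeI w \<longrightarrow> A w > 0"
    and Aneg: "\<forall>w\<in>W. \<not> typeI w \<longrightarrow> A w < 0"
    and Wdim: "aff_dim (convex hull W) = int CARD('r) - 1"
    and Cfin: "finite C"
    and Fnz: "\<forall>x\<in>C. F x \<noteq> 0"
    and Cnorm: "\<forall>x\<in>C. (\<Sum>i\<in>UNIV. x $ i) = (ndim d - 1) / 2"
    and sp: "superpotential d W A C F"
    and cC: "c \<in> C"
    and cvert: "c extreme_point_of (convex hull C)"
    and cnull: "null_vec d c"
  shows "convex hull ((\<lambda>w. (1/2) *\<^sub>R (dvec d + w)) ` W) \<subseteq> {x. Jform d c x \<ge> 0}"
proof (rule hull_minimal)
  show "convex {x. Jform d c x \<ge> 0}"
    by (auto simp: convex_def Jform_add_right Jform_scaleR_right)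
  \<comment> \<open>Since \<open>n\<close> is at least \<open>r\<close>, hence at least 2, the
    factor \<open>1 / (n - 1)\<close> in \<open>J\<close> is a genuine quotient.\<close>
  have "ndim d \<ge> (\<Sum>i\<in>(UNIV::'r set). 1)"
    unfolding ndim_def using dpos by (intro sum_mono) simp
  then have n1: "ndim d \<noteq> 1" using r2 by simp
  note nonneg = superpotential_nonneg_at_null_vertex[OF dpos n1 Wtypes Cfin Fnz Cnorm sp cC cvert cnull]
  show "(\<lambda>w. (1/2) *\<^sub>R (dvec d + w)) ` W \<subseteq> {x. Jform d c x \<ge> 0}"
  proof clarify
    fix w assume "w \<in> W"
    \<comment> \<open>As \<open>A w\<close> is nonzero, some pair in \<open>C\<close> must produce
      \<open>d + w\<close>, and both of its members already lie in the half-space.\<close>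
    then obtain p q where pq: "p \<in> C" "q \<in> C" "p + q = dvec d + w"
      using superpotential_sum_exists[OF sp] Anz by metis
    have "Jform d c (dvec d + w) \<ge> 0"
      using nonneg[OF pq(1)] nonneg[OF pq(2)] by (simp add: Jform_add_right flip: pq(3))
    then show "Jform d c ((1/2) *\<^sub>R (dvec d + w)) \<ge> 0"
      unfolding Jform_scaleR_right by simp
  qed
qed

end
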